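(* Suppose $(\mathfrak X,\mathcal V^* )$, with surjective summary maps $\{\sigma_t\}_{t=0}^{T+1}$, factorizes a compatible utility system $\mathbf U$ for the grand preference $\mathcal P$, and that the feasibility correspondences satisfy Markov feasibility and DP regularity (defined in the context). Let $J_t^*(x_t)=\sup_{\pi\in\Pi}U_t^{*\pi}(x_t)$, $t\in[T]$, and let $\bar\pi\in\Pi$ be any Bellman selector, i.e. $$\bar\pi_T(x_T)\in\arg\max_{c\in\mathcal A_T(x_T)}U_{T+1}^*(\Gamma_T(x_T,c,\star)),\quad\forall x_T\in\mathcal X_T,$$ $$\bar\pi_t(x_t)\in\arg\max_{c\in\mathcal A_t(x_t)}W_t^*\bigl(x_t,c,M_t^*(x_t,\tilde j^*_{t+1}(x_t,c))\bigr),\quad\forall x_t\in\mathcal X_t,\ t\in[T-1],$$ where $[\tilde j^*_{t+1}(x_t,c)](s)=J^*_{t+1}(\Gamma_t(x_t,c,s))$ for $s\in\mathcal S$. Let $\bar\varphi$ be its induced full-history policy, $\bar\varphi_t(h_t)=\bar\pi_t(\sigma_t(h_t))$. Then, for every feasible history-dependent policy $\varphi\in\Phi$, $$U_t^{\varphi}(h_t)\le J_t^*(\sigma_t(h_t))=U_t^{\bar\varphi}(h_t),\quad\forall h_t\in\mathcal H_t,\ t\in[T].$$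
   Context: **Primitives.** For an integer $n\ge 0$, $[n]=\{0,1,\dots,n\}$. $T\ge 1$ is an integer horizon. $\mathcal S$ is a finite nonempty set (discrete topology); $\mathcal S_0=\{\bar s_0\}$ is a singleton, $\mathcal S_t=\mathcal S$ for $1\le t\le T$, $\mathcal S_{T+1}=\{\star\}$. $\mathcal C=[0,\bar c]\subset\mathbb R_{\ge 0}$ is a compact interval. Histories: $\mathcal H_0=\{\bar s_0\}$, $\mathcal H_t=\mathcal H_{t-1}\times\mathcal C\times\mathcal S_t$ for $1\le t\le T$, $\mathcal H_{T+1}=\mathcal H_T\times\mathcal C$, with product topologies (compact metrizable). Extension maps $\iota_t:\mathcal H_t\times\mathcal C\times\mathcal S_{t+1}\to\mathcal H_{t+1}$: $\iota_t(h_t,c,s)=(h_t,c,s)$ for $t\in[T-1]$, $\iota_T(h_T,c,\star)=(h_T,c)$. Physical-state projections $\sigma^s_t:\mathcal H_t\to\mathcal S_t$: $\sigma_t^s(h_t)$ is the last state $s_t$ of $h_t$ for $t\in[T]$, and $\sigma^s_{T+1}\equiv\star$. Plans: $\mathcal F_{T+1}=\{\emptyset\}$ and $\mathcal F_t=\mathcal C\times(\mathcal F_{t+1})^{\mathcal S}$ for $t\in[T]$ (product topology); $\mathcal F_T$ is identified with $\mathcal C$. For $t\in[T-1]$ a plan is written $f=(c,f_+)$ with $c\in\mathcal C$, $f_+:\mathcal S\to\mathcal F_{t+1}$. $\mathcal L=\mathbb R^{\mathcal S}$ with sup norm and pointwise order; $\mathbf v\in\mathcal L$ is the constant vector with value $v$.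 **Preferences.** A grand preference is $\mathcal P=(\{\succeq_{(t)}\}_{t=0}^T,V_{T+1})$ with $\succeq_{(t)}$ a binary relation on $\mathcal H_t\times\mathcal F_t$ and $V_{T+1}:\mathcal H_{T+1}\to\mathbb R$ continuous. A utility system is $\mathbf U=\{U_t\}_{t=0}^{T+1}$ with $U_t:\mathcal H_t\times\mathcal F_t\to\mathbb R$ ($t\in[T]$) and $U_{T+1}:\mathcal H_{T+1}\to\mathbb R$ continuous. It is compatible with $\mathcal P$ if $U_{T+1}=V_{T+1}$; $U_T(h_T,c)=U_{T+1}(\iota_T(h_T,c,\star))$; and for all $t\in[T]$, $U_t(h_t,f)\ge U_t(h_t',g)\iff(h_t,f)\succeq_{(t)}(h_t',g)$. **PA-state systems.** A PA-state system is $\mathfrak X=(\{\mathcal X_t\}_{t=0}^{T+1},\{\varsigma_t\}_{t=0}^{T+1},\{\Gamma_t\}_{t=0}^{T})$ with $\mathcal X_t$ nonempty compact metrizable, $\varsigma_t:\mathcal X_t\to\mathcal S_t$ continuous, and $\Gamma_t:\mathcal X_t\times\mathcal C\times\mathcal S_{t+1}\to\mathcal X_{t+1}$ continuous with $\varsigma_{t+1}(\Gamma_t(x,c,s'))=s'$. A PA recursive structure on $\mathfrak X$ is $\mathcal V^*=(\{W_t^*\}_{t=0}^{T-1},\{M_t^*\}_{t=0}^{T-1},V_{T+1}^* )$ where $W_t^*:\mathcal X_t\times\mathcal C\times\mathbb R\to\mathbb R$ is jointly continuous and nondecreasing in its last argument; $M_t^*:\mathcal X_t\times\mathcal L\to\mathbb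 R$ is jointly continuous, monotone in $\tilde u\in\mathcal L$, and $M_t^*(x,\mathbf v)=v$ for all $x$, $v\in\mathbb R$; $V_{T+1}^*:\mathcal X_{T+1}\to\mathbb R$ is continuous. $(\mathfrak X,\mathcal V^* )$ generates $\{U_t^*\}$: $U_{T+1}^*=V_{T+1}^*$, $U_T^*(x_T,c)=U_{T+1}^*(\Gamma_T(x_T,c,\star))$, and for $t\in[T-1]$, $f=(c,f_+)$, $U_t^*(x_t,f)=W_t^*(x_t,c,M_t^*(x_t,\tilde u^*_{t+1}(x_t,f)))$ with $[\tilde u^*_{t+1}(x_t,f)](s)=U_{t+1}^*(\Gamma_t(x_t,c,s),f_+(s))$. **Factorization.** $(\mathfrak X,\mathcal V^* )$ with continuous summary maps $\sigma_t:\mathcal H_t\to\mathcal X_t$ factorizes $\mathbf U$ if $\varsigma_t\circ\sigma_t=\sigma_t^s$ ($t\in[T+1]$), $U_{T+1}=U_{T+1}^*\circ\sigma_{T+1}$, $U_t(h_t,f)=U_t^*(\sigma_t(h_t),f)$ for all $h_t,f$, $t\in[T]$, and $\sigma_{t+1}(\iota_t(h_t,c,s))=\Gamma_t(\sigma_t(h_t),c,s)$ for all $h_t,c,s\in\mathcal S_{t+1}$, $t\in[T]$. **Feasibility and policies.** For $t\in[T]$, $\mathcal A_t:\mathcal H_t\rightrightarrows\mathcal C$ is the correspondence of feasible consumption levels. $\Phi$ is the set of history-dependent policies $\varphi=(\varphi_t)_{t=0}^T$, arbitrary functions $\varphi_t:\mathcal H_t\to\mathcal C$ with $\varphi_t(h_t)\in\mathcal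 A_t(h_t)$. The plan induced by $\varphi$ from $h_t$ is $f_T^\varphi[h_T]=\varphi_T(h_T)$ and, for $t\in[T-1]$, $f_t^\varphi[h_t]=(c,f_+)$ with $c=\varphi_t(h_t)$ and $f_+(s)=f_{t+1}^\varphi[\iota_t(h_t,c,s)]$; $U_t^\varphi(h_t)=U_t(h_t,f_t^\varphi[h_t])$. Markov feasibility: if $\sigma_t(h_t)=\sigma_t(h_t')$ then $\mathcal A_t(h_t)=\mathcal A_t(h_t')$; one then writes $\mathcal A_t(x_t)=\mathcal A_t(h_t)$ for any $h_t\in\sigma_t^{-1}(x_t)$. DP regularity: for all $t\in[T]$, $\mathcal A_t:\mathcal X_t\rightrightarrows\mathcal C$ is continuous (upper and lower hemicontinuous) with nonempty compact values. $\Pi$ is the set of all PA Markov policies $\pi=\{\pi_t\}_{t=0}^T$, i.e. arbitrary functions $\pi_t:\mathcal X_t\to\mathcal C$ with $\pi_t(x_t)\in\mathcal A_t(x_t)$. Policy utilities: $U_{T+1}^{*\pi}=U_{T+1}^*$, $U_T^{*\pi}(x_T)=U_{T+1}^{*\pi}(\Gamma_T(x_T,\pi_T(x_T),\star))$, and for $t\in[T-1]$, $U_t^{*\pi}(x_t)=W_t^*(x_t,\pi_t(x_t),M_t^*(x_t,\tilde u_{t+1}^{*\pi}(x_t,\pi_t(x_t))))$ with $[\tilde u_{t+1}^{*\pi}(x_t,c)](s)=U_{t+1}^{*\pi}(\Gamma_t(x_t,c,s))$ for $s\in\mathcal S$. *)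

theory Defs
  imports "HOL-Analysis.Analysis"
begin

section \<open>Primitives\<close>

text \<open>All time-indexed spaces are families over \<^typ>\<open>nat\<close>, of which only the members with index
  at most \<open>T + 1\<close> (or \<open>T\<close>, or \<open>T - 1\<close>) matter. The labels \<open>s\<^sub>0\<close> (field \<open>init_state\<close>) and
  \<open>\<star>\<close> (field \<open>term_state\<close>) are arbitrary; they may or may not belong to \<open>S\<close> (field \<open>states\<close>).\<close>

record 's env =
  horizon :: nat
  states :: "'s set"
  init_state :: 's
  term_state :: 's
  cmax :: real

definition primitives :: "'s env \<Rightarrow> bool" where
  "primitives E \<longleftrightarrow> 1 \<le> horizon E \<and> finite (states E) \<and> states E \<noteq> {} \<and> 0 \<le> cmax E"

definition state_set :: "'s env \<Rightarrow> nat \<Rightarrow> 's set" where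
  "state_set E t =
     (if t = 0 then {init_state E} else if t \<le> horizon E then states E else {term_state E})"

definition cons_set :: "'s env \<Rightarrow> real set" where
  "cons_set E = {0..cmax E}"

definition cons_top :: "'s env \<Rightarrow> real topology" where
  "cons_top E = top_of_set (cons_set E)"

text \<open>The space \<open>L = \<real>\<^sup>S\<close>: extensional functions on \<open>S\<close>. For finite \<open>S\<close> the metric
  \<^term>\<open>funspace S euclidean_metric\<close> is that of the sup norm on all of \<open>L\<close>.\<close>

definition vec_set :: "'s env \<Rightarrow> ('s \<Rightarrow> real) set" where
  "vec_set E = states E \<rightarrow>\<^sub>E UNIV"

definition vec_top :: "'s env \<Rightarrow> ('s \<Rightarrow> real) topology" where
  "vec_top E = mtopology_of (funspace (states E) euclidean_metric)"

lemma topspace_cons_top [simp]: "topspace (cons_top E) = cons_set E"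
  by (simp add: cons_top_def)

lemma topspace_vec_top:
  assumes "primitives E"
  shows "topspace (vec_top E) = vec_set E"
proof -
  have "finite (states E)"
    using assms by (simp add: primitives_def)
  then show ?thesis
    by (auto simp: vec_top_def vec_set_def Met_TC.fspace_def PiE_def finite_imp_bounded)
qed

section \<open>Histories\<close>

text \<open>\<open>HEnd\<close> builds the elements of \<open>H\<^sub>T\<^sub>+\<^sub>1 = H\<^sub>T \<times> C\<close>.\<close>

datatype 's hist = HInit 's | HStep "'s hist" real 's | HEnd "'s hist" real

fun hist_set :: "'s env \<Rightarrow> nat \<Rightarrow> 's hist set" where
  "hist_set E 0 = {HInit (init_state E)}"
| "hist_set E (Suc t) =
     (if t < horizon E
      then {HStep h c s | h c s. h \<in> hist_set E t \<and> c \<in> cons_set E \<and> s \<in> state_set E (Suc t)}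
      else {HEnd h c | h c. h \<in> hist_set E t \<and> c \<in> cons_set E})"

fun step_parts :: "'s hist \<Rightarrow> 's hist \<times> real \<times> 's" where
  "step_parts (HStep h c s) = (h, c, s)"
| "step_parts _ = undefined"

fun end_parts :: "'s hist \<Rightarrow> 's hist \<times> real" where
  "end_parts (HEnd h c) = (h, c)"
| "end_parts _ = undefined"

text \<open>The product topologies, transported along the bijections \<open>step_parts\<close> and \<open>end_parts\<close>.\<close>

fun hist_top :: "'s env \<Rightarrow> nat \<Rightarrow> 's hist topology" where
  "hist_top E 0 = discrete_topology (hist_set E 0)"
| "hist_top E (Suc t) =
     (if t < horizon E
      then pullback_topology (hist_set E (Suc t)) step_parts
             (prod_topology (hist_top E t)
               (prod_topology (cons_top E) (discrete_topology (state_set E (Suc t)))))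
      else pullback_topology (hist_set E (Suc t)) end_parts
             (prod_topology (hist_top E t) (cons_top E)))"

lemma topspace_hist_top: "topspace (hist_top E t) = hist_set E t"
  by (induction t) (auto simp: topspace_pullback_topology)

definition hist_extend :: "'s env \<Rightarrow> nat \<Rightarrow> 's hist \<Rightarrow> real \<Rightarrow> 's \<Rightarrow> 's hist" where
  "hist_extend E t h c s = (if t < horizon E then HStep h c s else HEnd h c)"

fun last_state :: "'s env \<Rightarrow> 's hist \<Rightarrow> 's" where
  "last_state E (HInit s) = s"
| "last_state E (HStep h c s) = s"
| "last_state E (HEnd h c) = term_state E"

section \<open>Plans\<close>

datatype 's plan = PEnd | Plan (cons_now: real) (cont_plan: "'s \<Rightarrow> 's plan")

function plan_set :: "'s env \<Rightarrow> nat \<Rightarrow> 's plan set" where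
  "plan_set E t =
     (if t \<le> horizon E
      then {Plan c g | c g. c \<in> cons_set E \<and> g \<in> states E \<rightarrow>\<^sub>E plan_set E (Suc t)}
      else {PEnd})"
  by pat_completeness auto
termination by (relation "Wellfounded.measure (\<lambda>(E, t). Suc (horizon E) - t)") auto

declare plan_set.simps [simp del]

function plan_top :: "'s env \<Rightarrow> nat \<Rightarrow> 's plan topology" where
  "plan_top E t =
     (if t \<le> horizon E
      then pullback_topology (plan_set E t) (\<lambda>f. (cons_now f, cont_plan f))
             (prod_topology (cons_top E)
               (product_topology (\<lambda>_. plan_top E (Suc t)) (states E)))
      else discrete_topology {PEnd})"
  by pat_completeness auto
termination by (relation "Wellfounded.measure (\<lambda>(E, t). Suc (horizon E) - t)") auto

declare plan_top.simps [simp del]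

lemma topspace_plan_top: "topspace (plan_top E t) = plan_set E t"
proof (induction E t rule: plan_top.induct)
  case (1 E t)
  then show ?case
    by (subst plan_top.simps, subst (2) plan_set.simps)
      (auto simp: topspace_pullback_topology plan_set.simps [of E t] PiE_def Pi_def)
qed

text \<open>The identification of \<open>C\<close> with \<open>F\<^sub>T = C \<times> {\<emptyset>}\<^sup>S\<close>.\<close>

definition last_plan :: "'s env \<Rightarrow> real \<Rightarrow> 's plan" where
  "last_plan E c = Plan c (\<lambda>s\<in>states E. PEnd)"

lemma plan_set_horizon: "plan_set E (horizon E) = last_plan E ` cons_set E"
proof -
  have "(states E \<rightarrow>\<^sub>E {PEnd}) = {\<lambda>s\<in>states E. PEnd}"
    by (auto simp: PiE_iff fun_eq_iff extensional_def)
  then show ?thesis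
    by (auto simp: plan_set.simps [of E "horizon E"] plan_set.simps [of E "Suc (horizon E)"]
        last_plan_def)
qed

section \<open>Preferences and utility systems\<close>

record 's grand_pref =
  pref :: "nat \<Rightarrow> ('s hist \<times> 's plan) rel"
  pref_end :: "'s hist \<Rightarrow> real"

definition grand_preference :: "'s env \<Rightarrow> 's grand_pref \<Rightarrow> bool" where
  "grand_preference E P \<longleftrightarrow>
     (\<forall>t\<le>horizon E. pref P t \<subseteq> (hist_set E t \<times> plan_set E t) \<times> (hist_set E t \<times> plan_set E t)) \<and>
     continuous_map (hist_top E (horizon E + 1)) euclideanreal (pref_end P)"

record 's util_sys =
  util :: "nat \<Rightarrow> 's hist \<Rightarrow> 's plan \<Rightarrow> real"
  util_end :: "'s hist \<Rightarrow> real"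

definition utility_system :: "'s env \<Rightarrow> 's util_sys \<Rightarrow> bool" where
  "utility_system E U \<longleftrightarrow>
     (\<forall>t\<le>horizon E. continuous_map (prod_topology (hist_top E t) (plan_top E t)) euclideanreal
        (\<lambda>(h, f). util U t h f)) \<and>
     continuous_map (hist_top E (horizon E + 1)) euclideanreal (util_end U)"

definition compatible :: "'s env \<Rightarrow> 's grand_pref \<Rightarrow> 's util_sys \<Rightarrow> bool" where
  "compatible E P U \<longleftrightarrow>
     (\<forall>h\<in>hist_set E (horizon E + 1). util_end U h = pref_end P h) \<and>
     (\<forall>h\<in>hist_set E (horizon E). \<forall>c\<in>cons_set E.
        util U (horizon E) h (last_plan E c)
          = util_end U (hist_extend E (horizon E) h c (term_state E))) \<and>
     (\<forall>t\<le>horizon E. \<forall>h\<in>hist_set E t. \<forall>h'\<in>hist_set E t. \<forall>f\<in>plan_set E t. \<forall>g\<in>plan_set E t.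
        util U t h f \<ge> util U t h' g \<longleftrightarrow> ((h, f), (h', g)) \<in> pref P t)"

section \<open>PA-state systems and PA recursive structures\<close>

text \<open>The spaces \<open>X\<^sub>t\<close> share one carrier type; this is no restriction, since any family of spaces
  embeds in its disjoint union.\<close>

record ('s, 'x) pa_sys =
  pa_space :: "nat \<Rightarrow> 'x topology"
  pa_label :: "nat \<Rightarrow> 'x \<Rightarrow> 's"
  pa_trans :: "nat \<Rightarrow> 'x \<Rightarrow> real \<Rightarrow> 's \<Rightarrow> 'x"

definition pa_state_system :: "'s env \<Rightarrow> ('s, 'x) pa_sys \<Rightarrow> bool" where
  "pa_state_system E X \<longleftrightarrow>
     (\<forall>t\<le>horizon E + 1.
        topspace (pa_space X t) \<noteq> {} \<and> compact_space (pa_space X t) \<and>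
        metrizable_space (pa_space X t) \<and>
        continuous_map (pa_space X t) (discrete_topology (state_set E t)) (pa_label X t)) \<and>
     (\<forall>t\<le>horizon E.
        continuous_map
          (prod_topology (pa_space X t)
            (prod_topology (cons_top E) (discrete_topology (state_set E (t + 1)))))
          (pa_space X (t + 1)) (\<lambda>(x, c, s). pa_trans X t x c s) \<and>
        (\<forall>x\<in>topspace (pa_space X t). \<forall>c\<in>cons_set E. \<forall>s'\<in>state_set E (t + 1).
           pa_label X (t + 1) (pa_trans X t x c s') = s'))"

record ('s, 'x) pa_rec =
  aggr :: "nat \<Rightarrow> 'x \<Rightarrow> real \<Rightarrow> real \<Rightarrow> real"
  cert :: "nat \<Rightarrow> 'x \<Rightarrow> ('s \<Rightarrow> real) \<Rightarrow> real"
  end_val :: "'x \<Rightarrow> real"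

definition pa_recursive_structure ::
    "'s env \<Rightarrow> ('s, 'x) pa_sys \<Rightarrow> ('s, 'x) pa_rec \<Rightarrow> bool" where
  "pa_recursive_structure E X V \<longleftrightarrow>
     (\<forall>t<horizon E.
        continuous_map (prod_topology (pa_space X t) (prod_topology (cons_top E) euclideanreal))
          euclideanreal (\<lambda>(x, c, v). aggr V t x c v) \<and>
        (\<forall>x\<in>topspace (pa_space X t). \<forall>c\<in>cons_set E. mono (aggr V t x c)) \<and>
        continuous_map (prod_topology (pa_space X t) (vec_top E)) euclideanreal
          (\<lambda>(x, u). cert V t x u) \<and>
        (\<forall>x\<in>topspace (pa_space X t). \<forall>u\<in>vec_set E. \<forall>w\<in>vec_set E.
           (\<forall>s\<in>states E. u s \<le> w s) \<longrightarrow> cert V t x u \<le> cert V t x w) \<and>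
        (\<forall>x\<in>topspace (pa_space X t). \<forall>v. cert V t x (\<lambda>s\<in>states E. v) = v)) \<and>
     continuous_map (pa_space X (horizon E + 1)) euclideanreal (end_val V)"

text \<open>The generated utilities \<open>U\<^sup>*\<^sub>t\<close> for \<open>t \<le> T\<close>; \<open>U\<^sup>*\<^sub>T\<^sub>+\<^sub>1\<close> is \<^term>\<open>end_val V\<close>.\<close>

function pa_util ::
    "'s env \<Rightarrow> ('s, 'x) pa_sys \<Rightarrow> ('s, 'x) pa_rec \<Rightarrow> nat \<Rightarrow> 'x \<Rightarrow> 's plan \<Rightarrow> real" where
  "pa_util E X V t x f =
     (if t < horizon E
      then aggr V t x (cons_now f)
             (cert V t x
               (\<lambda>s\<in>states E.
                  pa_util E X V (Suc t) (pa_trans X t x (cons_now f) s) (cont_plan f s)))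
      else end_val V (pa_trans X t x (cons_now f) (term_state E)))"
  by pat_completeness auto
termination by (relation "Wellfounded.measure (\<lambda>(E, X, V, t, x, f). horizon E - t)") auto

declare pa_util.simps [simp del]

definition factorizes ::
    "'s env \<Rightarrow> ('s, 'x) pa_sys \<Rightarrow> ('s, 'x) pa_rec \<Rightarrow> (nat \<Rightarrow> 's hist \<Rightarrow> 'x) \<Rightarrow> 's util_sys \<Rightarrow> bool"
  where
  "factorizes E X V \<sigma> U \<longleftrightarrow>
     (\<forall>t\<le>horizon E + 1.
        continuous_map (hist_top E t) (pa_space X t) (\<sigma> t) \<and>
        (\<forall>h\<in>hist_set E t. pa_label X t (\<sigma> t h) = last_state E h)) \<and>
     (\<forall>h\<in>hist_set E (horizon E + 1). util_end U h = end_val V (\<sigma> (horizon E + 1) h)) \<and>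
     (\<forall>t\<le>horizon E. \<forall>h\<in>hist_set E t. \<forall>f\<in>plan_set E t.
        util U t h f = pa_util E X V t (\<sigma> t h) f) \<and>
     (\<forall>t\<le>horizon E. \<forall>h\<in>hist_set E t. \<forall>c\<in>cons_set E. \<forall>s\<in>state_set E (t + 1).
        \<sigma> (t + 1) (hist_extend E t h c s) = pa_trans X t (\<sigma> t h) c s)"

section \<open>Feasibility and policies\<close>

definition feasibility_correspondence :: "'s env \<Rightarrow> (nat \<Rightarrow> 's hist \<Rightarrow> real set) \<Rightarrow> bool" where
  "feasibility_correspondence E A \<longleftrightarrow> (\<forall>t\<le>horizon E. \<forall>h\<in>hist_set E t. A t h \<subseteq> cons_set E)"

definition history_policies ::
    "'s env \<Rightarrow> (nat \<Rightarrow> 's hist \<Rightarrow> real set) \<Rightarrow> (nat \<Rightarrow> 's hist \<Rightarrow> real) set" where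
  "history_policies E A = {\<phi>. \<forall>t\<le>horizon E. \<forall>h\<in>hist_set E t. \<phi> t h \<in> A t h}"

function induced_plan :: "'s env \<Rightarrow> (nat \<Rightarrow> 's hist \<Rightarrow> real) \<Rightarrow> nat \<Rightarrow> 's hist \<Rightarrow> 's plan" where
  "induced_plan E \<phi> t h =
     (if t < horizon E
      then Plan (\<phi> t h)
             (\<lambda>s\<in>states E. induced_plan E \<phi> (Suc t) (hist_extend E t h (\<phi> t h) s))
      else last_plan E (\<phi> t h))"
  by pat_completeness auto
termination by (relation "Wellfounded.measure (\<lambda>(E, \<phi>, t, h). horizon E - t)") auto

declare induced_plan.simps [simp del]

definition history_policy_util ::
    "'s env \<Rightarrow> 's util_sys \<Rightarrow> (nat \<Rightarrow> 's hist \<Rightarrow> real) \<Rightarrow> nat \<Rightarrow> 's hist \<Rightarrow> real" where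
  "history_policy_util E U \<phi> t h = util U t h (induced_plan E \<phi> t h)"

definition Markov_feasible ::
    "'s env \<Rightarrow> (nat \<Rightarrow> 's hist \<Rightarrow> 'x) \<Rightarrow> (nat \<Rightarrow> 's hist \<Rightarrow> real set) \<Rightarrow> bool" where
  "Markov_feasible E \<sigma> A \<longleftrightarrow>
     (\<forall>t\<le>horizon E. \<forall>h\<in>hist_set E t. \<forall>h'\<in>hist_set E t. \<sigma> t h = \<sigma> t h' \<longrightarrow> A t h = A t h')"

text \<open>\<open>A\<^sub>t(x) = A\<^sub>t(h)\<close> for any \<open>h \<in> \<sigma>\<^sub>t\<^sup>-\<^sup>1(x)\<close>; meaningful only for surjective
  \<open>\<sigma>\<^sub>t\<close> under Markov feasibility.\<close>

definition pa_feasible ::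
    "'s env \<Rightarrow> (nat \<Rightarrow> 's hist \<Rightarrow> 'x) \<Rightarrow> (nat \<Rightarrow> 's hist \<Rightarrow> real set) \<Rightarrow> nat \<Rightarrow> 'x \<Rightarrow> real set" where
  "pa_feasible E \<sigma> A t x = A t (inv_into (hist_set E t) (\<sigma> t) x)"

lemma pa_feasible_summary:
  assumes "Markov_feasible E \<sigma> A" "t \<le> horizon E" "h \<in> hist_set E t"
  shows "pa_feasible E \<sigma> A t (\<sigma> t h) = A t h"
proof -
  have "\<sigma> t h \<in> \<sigma> t ` hist_set E t"
    using assms by blast
  then show ?thesis
    using assms unfolding Markov_feasible_def pa_feasible_def
    by (meson f_inv_into_f inv_into_into)
qed

definition upper_hemicontinuous_map :: "'a topology \<Rightarrow> 'b topology \<Rightarrow> ('a \<Rightarrow> 'b set) \<Rightarrow> bool" where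
  "upper_hemicontinuous_map X Y F \<longleftrightarrow>
     (\<forall>G. openin Y G \<longrightarrow> openin X {x \<in> topspace X. F x \<subseteq> G})"

definition lower_hemicontinuous_map :: "'a topology \<Rightarrow> 'b topology \<Rightarrow> ('a \<Rightarrow> 'b set) \<Rightarrow> bool" where
  "lower_hemicontinuous_map X Y F \<longleftrightarrow>
     (\<forall>G. openin Y G \<longrightarrow> openin X {x \<in> topspace X. F x \<inter> G \<noteq> {}})"

definition DP_regular ::
    "'s env \<Rightarrow> ('s, 'x) pa_sys \<Rightarrow> (nat \<Rightarrow> 's hist \<Rightarrow> 'x) \<Rightarrow> (nat \<Rightarrow> 's hist \<Rightarrow> real set) \<Rightarrow> bool"
  where
  "DP_regular E X \<sigma> A \<longleftrightarrow>
     (\<forall>t\<le>horizon E.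
        upper_hemicontinuous_map (pa_space X t) (cons_top E) (pa_feasible E \<sigma> A t) \<and>
        lower_hemicontinuous_map (pa_space X t) (cons_top E) (pa_feasible E \<sigma> A t) \<and>
        (\<forall>x\<in>topspace (pa_space X t).
           pa_feasible E \<sigma> A t x \<noteq> {} \<and> compactin (cons_top E) (pa_feasible E \<sigma> A t x)))"

definition Markov_policies ::
    "'s env \<Rightarrow> ('s, 'x) pa_sys \<Rightarrow> (nat \<Rightarrow> 's hist \<Rightarrow> 'x) \<Rightarrow> (nat \<Rightarrow> 's hist \<Rightarrow> real set) \<Rightarrow>
     (nat \<Rightarrow> 'x \<Rightarrow> real) set" where
  "Markov_policies E X \<sigma> A =
     {\<pi>. \<forall>t\<le>horizon E. \<forall>x\<in>topspace (pa_space X t). \<pi> t x \<in> pa_feasible E \<sigma> A t x}"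

function Markov_policy_util ::
    "'s env \<Rightarrow> ('s, 'x) pa_sys \<Rightarrow> ('s, 'x) pa_rec \<Rightarrow> (nat \<Rightarrow> 'x \<Rightarrow> real) \<Rightarrow> nat \<Rightarrow> 'x \<Rightarrow> real" where
  "Markov_policy_util E X V \<pi> t x =
     (if t < horizon E
      then aggr V t x (\<pi> t x)
             (cert V t x
               (\<lambda>s\<in>states E. Markov_policy_util E X V \<pi> (Suc t) (pa_trans X t x (\<pi> t x) s)))
      else if t = horizon E
      then Markov_policy_util E X V \<pi> (Suc t) (pa_trans X t x (\<pi> t x) (term_state E))
      else end_val V x)"
  by pat_completeness auto
termination by (relation "Wellfounded.measure (\<lambda>(E, X, V, \<pi>, t, x). Suc (horizon E) - t)") auto

declare Markov_policy_util.simps [simp del]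

definition value_fun ::
    "'s env \<Rightarrow> ('s, 'x) pa_sys \<Rightarrow> ('s, 'x) pa_rec \<Rightarrow> (nat \<Rightarrow> 's hist \<Rightarrow> 'x) \<Rightarrow>
     (nat \<Rightarrow> 's hist \<Rightarrow> real set) \<Rightarrow> nat \<Rightarrow> 'x \<Rightarrow> real" where
  "value_fun E X V \<sigma> A t x = (SUP \<pi>\<in>Markov_policies E X \<sigma> A. Markov_policy_util E X V \<pi> t x)"

definition Bellman_selector ::
    "'s env \<Rightarrow> ('s, 'x) pa_sys \<Rightarrow> ('s, 'x) pa_rec \<Rightarrow> (nat \<Rightarrow> 's hist \<Rightarrow> 'x) \<Rightarrow>
     (nat \<Rightarrow> 's hist \<Rightarrow> real set) \<Rightarrow> (nat \<Rightarrow> 'x \<Rightarrow> real) \<Rightarrow> bool" where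
  "Bellman_selector E X V \<sigma> A \<pi> \<longleftrightarrow>
     \<pi> \<in> Markov_policies E X \<sigma> A \<and>
     (\<forall>x\<in>topspace (pa_space X (horizon E)).
        is_arg_max (\<lambda>c. end_val V (pa_trans X (horizon E) x c (term_state E)))
          (\<lambda>c. c \<in> pa_feasible E \<sigma> A (horizon E) x) (\<pi> (horizon E) x)) \<and>
     (\<forall>t<horizon E. \<forall>x\<in>topspace (pa_space X t).
        is_arg_max
          (\<lambda>c. aggr V t x c
                 (cert V t x (\<lambda>s\<in>states E. value_fun E X V \<sigma> A (t + 1) (pa_trans X t x c s))))
          (\<lambda>c. c \<in> pa_feasible E \<sigma> A t x) (\<pi> t x))"

end

theory Submission
  imports Defs
begin

text \<open>Backward induction on \<open>t\<close>, in utilities of histories. A Markov policy composed with the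
  summary maps is a feasible history-dependent policy with the same utility, so a bound on all
  history-dependent policies at \<open>t + 1\<close> bounds all Markov policies there and identifies
  \<open>J\<^sup>*\<^sub>t\<^sub>+\<^sub>1\<close> with the utility of the selector. At \<open>t\<close>, monotonicity of the certainty equivalent and
  of the aggregator replaces the continuation of an arbitrary policy by \<open>J\<^sup>*\<^sub>t\<^sub>+\<^sub>1\<close>, and the arg max
  property replaces its current choice by that of the selector.\<close>

lemma state_set_Suc: "t < horizon E \<Longrightarrow> state_set E (Suc t) = states E"
  by (simp add: state_set_def)

lemma hist_extend_in_hist_set:
  assumes "t < horizon E" "h \<in> hist_set E t" "c \<in> cons_set E" "s \<in> states E"
  shows "hist_extend E t h c s \<in> hist_set E (Suc t)"
  using assms by (auto simp: hist_extend_def state_set_Suc)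

lemma history_policy_in_cons_set:
  assumes "feasibility_correspondence E A" "\<phi> \<in> history_policies E A"
    and "t \<le> horizon E" "h \<in> hist_set E t"
  shows "\<phi> t h \<in> cons_set E"
  using assms by (fastforce simp: feasibility_correspondence_def history_policies_def)

text \<open>Factorization equates \<open>util\<close> with \<open>pa_util\<close> only on
  \<open>plan_set\<close>, so an induced plan must be placed there before its utility can be
  rewritten through summaries.\<close>

lemma induced_plan_in_plan_set:
  assumes "feasibility_correspondence E A" "\<phi> \<in> history_policies E A"
    and "t \<le> horizon E" "h \<in> hist_set E t"
  shows "induced_plan E \<phi> t h \<in> plan_set E t"
  using assms(3,4)
\<comment> \<open>Backward in time: \<open>inc_induct\<close> starts at the horizon and descends
  from \<open>Suc t\<close> to \<open>t\<close>.\<close>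
proof (induction t arbitrary: h rule: inc_induct)
  case base
  then have "\<phi> (horizon E) h \<in> cons_set E"
    using history_policy_in_cons_set[OF assms(1,2)] by blast
  then show ?case
    by (simp add: induced_plan.simps plan_set_horizon)
next
  case (step t)
  have c: "\<phi> t h \<in> cons_set E"
    using history_policy_in_cons_set[OF assms(1,2)] step by simp
  have "induced_plan E \<phi> (Suc t) (hist_extend E t h (\<phi> t h) s) \<in> plan_set E (Suc t)"
    if "s \<in> states E" for s
    using step c that by (intro step.IH hist_extend_in_hist_set)
  then show ?case
    using step.hyps c by (simp add: induced_plan.simps[of E \<phi> t] plan_set.simps[of E t])
qed

lemma summary_extend:
  assumes "factorizes E X V \<sigma> U" "t < horizon E"
    and "h \<in> hist_set E t" "c \<in> cons_set E" "s \<in> states E"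
  shows "pa_trans X t (\<sigma> t h) c s = \<sigma> (Suc t) (hist_extend E t h c s)"
  using assms by (simp add: factorizes_def state_set_Suc)

lemma summary_in_topspace:
  assumes "factorizes E X V \<sigma> U" "t \<le> horizon E + 1" "h \<in> hist_set E t"
  shows "\<sigma> t h \<in> topspace (pa_space X t)"
  using assms continuous_map_funspace[of "hist_top E t" "pa_space X t" "\<sigma> t"]
  by (auto simp: factorizes_def topspace_hist_top)

lemma history_policy_util_horizon:
  assumes "factorizes E X V \<sigma> U"
    and "feasibility_correspondence E A" "\<phi> \<in> history_policies E A"
    and "h \<in> hist_set E (horizon E)"
  shows "history_policy_util E U \<phi> (horizon E) h =
    end_val V (pa_trans X (horizon E) (\<sigma> (horizon E) h) (\<phi> (horizon E) h) (term_state E))"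
proof -
  have "history_policy_util E U \<phi> (horizon E) h =
      pa_util E X V (horizon E) (\<sigma> (horizon E) h) (induced_plan E \<phi> (horizon E) h)"
    using assms induced_plan_in_plan_set[OF assms(2,3) order_refl]
    by (simp add: history_policy_util_def factorizes_def)
  then show ?thesis
    by (simp add: pa_util.simps induced_plan.simps last_plan_def)
qed

text \<open>The continuation of an induced plan is the plan induced from the extended history, and
  the summary maps carry \<open>hist_extend\<close> to \<open>pa_trans\<close>. Hence policy
  utilities on histories inherit the recursion that defines \<open>pa_util\<close>.\<close>

lemma history_policy_util_step:
  assumes "factorizes E X V \<sigma> U"
    and "feasibility_correspondence E A" "\<phi> \<in> history_policies E A"
    and "t < horizon E" "h \<in> hist_set E t"
  shows "history_policy_util E U \<phi> t h =
    aggr V t (\<sigma> t h) (\<phi> t h) (cert V t (\<sigma> t h)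
      (\<lambda>s\<in>states E. history_policy_util E U \<phi> (Suc t) (hist_extend E t h (\<phi> t h) s)))"
proof -
  let ?h = "\<lambda>s. hist_extend E t h (\<phi> t h) s"
  \<comment> \<open>Used at \<open>h\<close> itself and again at each extension
    \<open>?h s\<close>.\<close>
  have util: "history_policy_util E U \<phi> k g = pa_util E X V k (\<sigma> k g) (induced_plan E \<phi> k g)"
    if "k \<le> horizon E" "g \<in> hist_set E k" for k g
    using assms(1) that induced_plan_in_plan_set[OF assms(2,3) that]
    by (simp add: history_policy_util_def factorizes_def)
  have c: "\<phi> t h \<in> cons_set E"
    using history_policy_in_cons_set[OF assms(2,3)] assms(4,5) by simp
  have "pa_util E X V (Suc t) (pa_trans X t (\<sigma> t h) (\<phi> t h) s) (induced_plan E \<phi> (Suc t) (?h s))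
      = history_policy_util E U \<phi> (Suc t) (?h s)" if "s \<in> states E" for s
    using util[of "Suc t" "?h s"] hist_extend_in_hist_set[OF assms(4,5) c that]
      summary_extend[OF assms(1,4,5) c that] assms(4) by simp
  then have "(\<lambda>s\<in>states E. pa_util E X V (Suc t) (pa_trans X t (\<sigma> t h) (\<phi> t h) s)
        (induced_plan E \<phi> (Suc t) (?h s)))
      = (\<lambda>s\<in>states E. history_policy_util E U \<phi> (Suc t) (?h s))"
    by (rule restrict_ext)
  then show ?thesis
    using util[of t h] assms(4,5)
    by (simp add: pa_util.simps[of E X V t] induced_plan.simps[of E \<phi> t] cong: restrict_cong)
qed

text \<open>\<open>pa_feasible\<close> evaluates \<open>A\<close> at a chosen history with the given
  summary; Markov feasibility makes this agree with \<open>A\<close> at the actual history. Values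
  of \<phi> off \<open>hist_set\<close> are left free, since feasibility does not constrain
  them.\<close>

lemma Markov_policy_in_history_policies:
  assumes "factorizes E X V \<sigma> U" "Markov_feasible E \<sigma> A" "\<pi> \<in> Markov_policies E X \<sigma> A"
    and "\<forall>t\<le>horizon E. \<forall>h\<in>hist_set E t. \<phi> t h = \<pi> t (\<sigma> t h)"
  shows "\<phi> \<in> history_policies E A"
  unfolding history_policies_def
proof (intro CollectI allI impI ballI)
  fix t h
  assume t: "t \<le> horizon E" and h: "h \<in> hist_set E t"
  have "\<sigma> t h \<in> topspace (pa_space X t)"
    using summary_in_topspace[OF assms(1) _ h] t by simp
  then have "\<pi> t (\<sigma> t h) \<in> pa_feasible E \<sigma> A t (\<sigma> t h)"
    using assms(3) t by (simp add: Markov_policies_def)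
  then show "\<phi> t h \<in> A t h"
    using pa_feasible_summary[OF assms(2) t h] assms(4) t h by simp
qed

text \<open>Both sides obey the same recursion with the same end values, because \<phi> and \<pi>
  choose the same consumption at a history and at its summary.\<close>

lemma history_policy_util_Markov:
  assumes "factorizes E X V \<sigma> U" "feasibility_correspondence E A" "Markov_feasible E \<sigma> A"
    and "\<pi> \<in> Markov_policies E X \<sigma> A"
    and \<phi>: "\<forall>t\<le>horizon E. \<forall>h\<in>hist_set E t. \<phi> t h = \<pi> t (\<sigma> t h)"
    and "t \<le> horizon E" "h \<in> hist_set E t"
  shows "history_policy_util E U \<phi> t h = Markov_policy_util E X V \<pi> t (\<sigma> t h)"
  using assms(6,7)
proof (induction t arbitrary: h rule: inc_induct)
  case base
  have "\<phi> \<in> history_policies E A"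
    using Markov_policy_in_history_policies assms(1,3,4,5) by blast
  \<comment> \<open>At the horizon \<open>Markov_policy_util\<close> passes through the extra stage
    \<open>Suc (horizon E)\<close>, where it equals \<open>end_val V\<close>; both stages are
    unfolded.\<close>
  then show ?case
    using history_policy_util_horizon[OF assms(1,2) _ base] \<phi> base
    by (simp add: Markov_policy_util.simps)
next
  case (step t)
  have pol: "\<phi> \<in> history_policies E A"
    using Markov_policy_in_history_policies assms(1,3,4,5) by blast
  have c: "\<phi> t h \<in> cons_set E"
    using history_policy_in_cons_set[OF assms(2) pol] step by simp
  have "history_policy_util E U \<phi> (Suc t) (hist_extend E t h (\<phi> t h) s)
      = Markov_policy_util E X V \<pi> (Suc t) (pa_trans X t (\<sigma> t h) (\<phi> t h) s)"
    if "s \<in> states E" for s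
    using step.IH[OF hist_extend_in_hist_set] summary_extend[OF assms(1)] step.hyps step.prems c that
    by simp
  then have "(\<lambda>s\<in>states E. history_policy_util E U \<phi> (Suc t) (hist_extend E t h (\<phi> t h) s))
      = (\<lambda>s\<in>states E. Markov_policy_util E X V \<pi> (Suc t) (pa_trans X t (\<sigma> t h) (\<phi> t h) s))"
    by (rule restrict_ext)
  then show ?case
    using history_policy_util_step[OF assms(1,2) pol] \<phi> step.hyps step.prems
    by (simp add: Markov_policy_util.simps[of E X V \<pi> t])
qed

text \<open>Every Markov policy, composed with the summary maps, is among the policies covered by
  \<open>bound\<close>. The supremum is therefore a maximum attained at \<pi>, which also settles
  boundedness for the real \<open>SUP\<close>.\<close>

lemma value_fun_eq_Markov_policy_util:
  assumes "factorizes E X V \<sigma> U" "feasibility_correspondence E A" "Markov_feasible E \<sigma> A"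
    and "\<pi> \<in> Markov_policies E X \<sigma> A" "t \<le> horizon E" "h \<in> hist_set E t"
    and bound: "\<And>\<phi>. \<phi> \<in> history_policies E A \<Longrightarrow>
      history_policy_util E U \<phi> t h \<le> Markov_policy_util E X V \<pi> t (\<sigma> t h)"
  shows "value_fun E X V \<sigma> A t (\<sigma> t h) = Markov_policy_util E X V \<pi> t (\<sigma> t h)"
  unfolding value_fun_def
proof (rule cSup_eq_maximum)
  show "Markov_policy_util E X V \<pi> t (\<sigma> t h)
      \<in> (\<lambda>\<pi>. Markov_policy_util E X V \<pi> t (\<sigma> t h)) ` Markov_policies E X \<sigma> A"
    using assms(4) by blast
next
  fix v
  assume "v \<in> (\<lambda>\<pi>. Markov_policy_util E X V \<pi> t (\<sigma> t h)) ` Markov_policies E X \<sigma> A"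
  then obtain \<rho> where \<rho>: "\<rho> \<in> Markov_policies E X \<sigma> A"
    and v: "v = Markov_policy_util E X V \<rho> t (\<sigma> t h)"
    by blast
  let ?\<phi> = "\<lambda>t h. \<rho> t (\<sigma> t h)"
  have "v = history_policy_util E U ?\<phi> t h"
    using history_policy_util_Markov[OF assms(1-3) \<rho> _ assms(5,6)] v by simp
  moreover have "?\<phi> \<in> history_policies E A"
    using Markov_policy_in_history_policies[OF assms(1,3) \<rho>] by simp
  ultimately show "v \<le> Markov_policy_util E X V \<pi> t (\<sigma> t h)"
    using bound by simp
qed

text \<open>Bounding by the utility of the selector rather than by \<open>value_fun\<close> lets the
  induction close: the value function at the next date is recovered from the bound there.\<close>

lemma history_policy_util_le_Bellman_selector:
  assumes "pa_recursive_structure E X V" "factorizes E X V \<sigma> U"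
    and "feasibility_correspondence E A" "Markov_feasible E \<sigma> A" "Bellman_selector E X V \<sigma> A \<pi>"
    and "\<phi> \<in> history_policies E A" "t \<le> horizon E" "h \<in> hist_set E t"
  shows "history_policy_util E U \<phi> t h \<le> Markov_policy_util E X V \<pi> t (\<sigma> t h)"
  using assms(7,6,8)
\<comment> \<open>\<phi> stays arbitrary because identifying \<open>value_fun\<close> at
  \<open>Suc t\<close> takes the bound for all policies, not just the one at hand.\<close>
proof (induction t arbitrary: \<phi> h rule: inc_induct)
  case base
  have "\<phi> (horizon E) h \<in> pa_feasible E \<sigma> A (horizon E) (\<sigma> (horizon E) h)"
    using base pa_feasible_summary[OF assms(4)] by (simp add: history_policies_def)
  then show ?case
    using history_policy_util_horizon[OF assms(2,3) base] summary_in_topspace[OF assms(2) _ base(2)]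
      assms(5)
    by (simp add: Markov_policy_util.simps Bellman_selector_def is_arg_max_linorder)
next
  case (step t)
  let ?x = "\<sigma> t h" and ?J = "value_fun E X V \<sigma> A (Suc t)"
  have \<pi>: "\<pi> \<in> Markov_policies E X \<sigma> A"
    using assms(5) by (simp add: Bellman_selector_def)
  have x: "?x \<in> topspace (pa_space X t)"
    using summary_in_topspace[OF assms(2)] step by simp
  have feas: "\<phi> t h \<in> pa_feasible E \<sigma> A t ?x"
    using step pa_feasible_summary[OF assms(4)] by (simp add: history_policies_def)
  have c: "\<phi> t h \<in> cons_set E"
    using history_policy_in_cons_set[OF assms(3)] step by simp
  \<comment> \<open>\<open>A\<close> is known to lie in \<open>cons_set E\<close> at histories, so
    feasibility at the state is first moved back to \<open>A t h\<close>.\<close>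
  have d: "\<pi> t ?x \<in> cons_set E"
  proof -
    have "\<pi> t ?x \<in> pa_feasible E \<sigma> A t ?x"
      using \<pi> x step.hyps by (simp add: Markov_policies_def)
    also have "\<dots> = A t h"
      using pa_feasible_summary[OF assms(4)] step.hyps step.prems by simp
    also have "\<dots> \<subseteq> cons_set E"
      using assms(3) step.hyps step.prems by (simp add: feasibility_correspondence_def)
    finally show ?thesis .
  qed
  \<comment> \<open>The induction hypothesis, over all policies, makes the selector optimal at the
    next date.\<close>
  have J: "?J (\<sigma> (Suc t) g) = Markov_policy_util E X V \<pi> (Suc t) (\<sigma> (Suc t) g)"
    if "g \<in> hist_set E (Suc t)" for g
    using value_fun_eq_Markov_policy_util[OF assms(2-4) \<pi> _ that] step.IH that step.hyps by simp
  \<comment> \<open>After any consumption choice the next state is the summary of an extended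
    history, which is where \<open>J\<close> applies.\<close>
  have J_trans: "?J (pa_trans X t ?x b s)
      = Markov_policy_util E X V \<pi> (Suc t) (\<sigma> (Suc t) (hist_extend E t h b s))"
    if "b \<in> cons_set E" "s \<in> states E" for b s
    using J[OF hist_extend_in_hist_set[OF step.hyps(2) step.prems(2) that]]
      summary_extend[OF assms(2) step.hyps(2) step.prems(2) that] by simp
  let ?u = "\<lambda>s\<in>states E. history_policy_util E U \<phi> (Suc t) (hist_extend E t h (\<phi> t h) s)"
  have "cert V t ?x ?u \<le> cert V t ?x (\<lambda>s\<in>states E. ?J (pa_trans X t ?x (\<phi> t h) s))"
  proof -
    have "?u s \<le> (\<lambda>s\<in>states E. ?J (pa_trans X t ?x (\<phi> t h) s)) s" if "s \<in> states E" for s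
      using step.IH[OF step.prems(1) hist_extend_in_hist_set] J_trans[OF c that] c that
        step.hyps step.prems by simp
    moreover have "?u \<in> vec_set E" "(\<lambda>s\<in>states E. ?J (pa_trans X t ?x (\<phi> t h) s)) \<in> vec_set E"
      by (auto simp: vec_set_def)
    ultimately show ?thesis
      using assms(1) x step.hyps unfolding pa_recursive_structure_def by blast
  qed
  moreover have "mono (aggr V t ?x (\<phi> t h))"
    using assms(1) x c step.hyps by (simp add: pa_recursive_structure_def)
  ultimately have "history_policy_util E U \<phi> t h
      \<le> aggr V t ?x (\<phi> t h) (cert V t ?x (\<lambda>s\<in>states E. ?J (pa_trans X t ?x (\<phi> t h) s)))"
    using history_policy_util_step[OF assms(2,3)] step by (simp add: monoD)
  also have "\<dots> \<le> aggr V t ?x (\<pi> t ?x)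
      (cert V t ?x (\<lambda>s\<in>states E. ?J (pa_trans X t ?x (\<pi> t ?x) s)))"
    using assms(5) x feas step.hyps by (simp add: Bellman_selector_def is_arg_max_linorder)
  \<comment> \<open>At the selector's own choice the next value is its own utility, so the Bellman
    expression is one step of \<open>Markov_policy_util\<close>.\<close>
  also have "\<dots> = Markov_policy_util E X V \<pi> t ?x"
  proof -
    have "(\<lambda>s\<in>states E. ?J (pa_trans X t ?x (\<pi> t ?x) s))
        = (\<lambda>s\<in>states E. Markov_policy_util E X V \<pi> (Suc t) (pa_trans X t ?x (\<pi> t ?x) s))"
      using J_trans[OF d] summary_extend[OF assms(2)] d step.hyps step.prems
      by (intro restrict_ext) simp
    then show ?thesis
      using step.hyps by (simp add: Markov_policy_util.simps[of E X V \<pi> t])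
  qed
  finally show ?case .
qed

theorem theorem5p5:
  fixes E :: "'s env"
    and P :: "'s grand_pref"
    and U :: "'s util_sys"
    and X :: "('s, 'x) pa_sys"
    and V :: "('s, 'x) pa_rec"
    and \<sigma> :: "nat \<Rightarrow> 's hist \<Rightarrow> 'x"
    and A :: "nat \<Rightarrow> 's hist \<Rightarrow> real set"
    and \<pi>bar :: "nat \<Rightarrow> 'x \<Rightarrow> real"
    and \<phi>bar :: "nat \<Rightarrow> 's hist \<Rightarrow> real"
  assumes "primitives E"
    and "grand_preference E P"
    and "utility_system E U"
    and "compatible E P U"
    and "pa_state_system E X"
    and "pa_recursive_structure E X V"
    and "factorizes E X V \<sigma> U"
    and "\<forall>t\<le>horizon E + 1. \<sigma> t ` hist_set E t = topspace (pa_space X t)"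
    and "feasibility_correspondence E A"
    and "Markov_feasible E \<sigma> A"
    and "DP_regular E X \<sigma> A"
    and "Bellman_selector E X V \<sigma> A \<pi>bar"
    and "\<forall>t\<le>horizon E. \<forall>h\<in>hist_set E t. \<phi>bar t h = \<pi>bar t (\<sigma> t h)"
  shows "\<forall>\<phi>\<in>history_policies E A. \<forall>t\<le>horizon E. \<forall>h\<in>hist_set E t.
           history_policy_util E U \<phi> t h \<le> value_fun E X V \<sigma> A t (\<sigma> t h) \<and>
           value_fun E X V \<sigma> A t (\<sigma> t h) = history_policy_util E U \<phi>bar t h"
proof (intro ballI allI impI)
  fix \<phi> t h
  assume \<phi>: "\<phi> \<in> history_policies E A" and t: "t \<le> horizon E" and h: "h \<in> hist_set E t"
  have \<pi>: "\<pi>bar \<in> Markov_policies E X \<sigma> A"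
    using assms(12) by (simp add: Bellman_selector_def)
  \<comment> \<open>The policy is left open: the bound over all policies identifies
    \<open>value_fun\<close>, and its instance at \<phi> gives the inequality.\<close>
  note bound = history_policy_util_le_Bellman_selector[OF assms(6,7,9,10,12) _ t h]
  have "value_fun E X V \<sigma> A t (\<sigma> t h) = Markov_policy_util E X V \<pi>bar t (\<sigma> t h)"
    using value_fun_eq_Markov_policy_util[OF assms(7,9,10) \<pi> t h] bound by simp
  moreover have "history_policy_util E U \<phi>bar t h = Markov_policy_util E X V \<pi>bar t (\<sigma> t h)"
    using history_policy_util_Markov[OF assms(7,9,10) \<pi> assms(13) t h] .
  ultimately show "history_policy_util E U \<phi> t h \<le> value_fun E X V \<sigma> A t (\<sigma> t h) \<and>
      value_fun E X V \<sigma> A t (\<sigma> t h) = history_policy_util E U \<phi>bar t h"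
    using bound[OF \<phi>] by simp
qed

end
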